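(* Let $A$ be an $m\times m$ matrix with real coefficients and let $F_A:\mathbb{R}^m\to\mathbb{R}^m$, $F_A(x)=x+(Ax)^3$. Then $F_A$ is proper if one of the following conditions is satisfied: (1) $\mathrm{Ker}(A)\subset \mathrm{Ker}(AA^T)$ (this holds for example when $A$ is invertible, symmetric or anti-symmetric). (2) $AA^T$ has rank $1$. (3) $A$ is an upper or lower triangular matrix. (4) The map $F_B(x)=x+(Bx)^3$ is proper, where $B=DAD^{-3}$ for an invertible diagonal real matrix $D$. (5) There is a vector $\zeta=(\zeta_1,\ldots,\zeta_m)$ with $\zeta_i>0$ for all $i$ such that $\langle A(x^3),\zeta*x\rangle\geq 0$ for all $x\in\mathrm{Im}(AA^T)$. (6) $\mathrm{Ker}(A)$ is generated by the vector $x_\infty=(1,\ldots,1)$ and $x_\infty\notin \mathrm{Im}(AA^T)\cap\mathrm{Im}(AAA^T)$. Moreover, if (5) holds with a vector $\zeta$ for which in addition $\langle A(x^3),\zeta*x\rangle\neq 0$ for all $0\neq x\in\mathrm{Im}(AA^T)$, then the map $F_{-A}(x)=x+(-Ax)^3=x-(Ax)^3$ is also proper.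
   Context: For $x,y\in\mathbb{R}^m$, $x*y=(x_1y_1,\ldots,x_my_m)$ is the coordinatewise product and $x^3=x*x*x$. $\langle\cdot,\cdot\rangle$ is the usual inner product on $\mathbb{R}^m$. $A^T$ is the transpose of $A$, $\mathrm{Ker}(A)=\{x:Ax=0\}$, $\mathrm{Im}(A)=A(\mathbb{R}^m)$. A map is proper if preimages of compact sets are compact. *)

theory Defs
  imports "HOL-Analysis.Analysis"
begin

text \<open>
  On \<open>real^'n\<close> the library's \<open>*\<close>, \<open>^\<close> and \<open>1\<close> are coordinatewise: \<open>x * y\<close> is the
  coordinatewise product, \<open>x ^ 3 = x * x * x\<close>, and \<open>1\<close> is the vector \<open>(1, \<dots>, 1)\<close>.
  They are coordinatewise on matrices too, so matrix products and powers are written with \<open>**\<close>.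
\<close>

definition cubic_map :: "real^'n^'n \<Rightarrow> real^'n \<Rightarrow> real^'n" where
  "cubic_map A x = x + (A *v x) ^ 3"

text \<open>
  The library's \<open>proper_map\<close> means a closed map with compact fibres; here properness is the
  compactness of all preimages of compact sets.
\<close>
definition proper :: "('a::topological_space \<Rightarrow> 'b::topological_space) \<Rightarrow> bool" where
  "proper f \<longleftrightarrow> (\<forall>K. compact K \<longrightarrow> compact (f -` K))"

definition mat_ker :: "real^'n^'m \<Rightarrow> (real^'n) set" where
  "mat_ker A = {x. A *v x = 0}"

definition mat_im :: "real^'n^'m \<Rightarrow> (real^'m) set" where
  "mat_im A = range (\<lambda>x. A *v x)"

definition diagonal_matrix :: "real^'n^'n \<Rightarrow> bool" where
  "diagonal_matrix D \<longleftrightarrow> (\<forall>i j. i \<noteq> j \<longrightarrow> D $ i $ j = 0)"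

text \<open>The linear order on the finite index type plays the role of the order of \<open>1, \<dots>, m\<close>.\<close>

definition upper_triangular_matrix :: "real^('n::{finite,linorder})^('n::{finite,linorder}) \<Rightarrow> bool" where
  "upper_triangular_matrix A \<longleftrightarrow> (\<forall>i j. j < i \<longrightarrow> A $ i $ j = 0)"

definition lower_triangular_matrix :: "real^('n::{finite,linorder})^('n::{finite,linorder}) \<Rightarrow> bool" where
  "lower_triangular_matrix A \<longleftrightarrow> (\<forall>i j. i < j \<longrightarrow> A $ i $ j = 0)"

end

theory Submission
  imports Defs
begin

text \<open>If \<open>cubic_map A\<close> is not proper, then \<open>z = A *v x\<close> is unbounded along a sequence on which
  \<open>cubic_map A x\<close> is bounded. Applying \<open>A\<close> to \<open>x + z ^ 3 = cubic_map A x\<close> shows that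
  \<open>z + A *v (z ^ 3)\<close> is bounded, so dividing by \<open>norm z ^ 3\<close> every limit direction \<open>w\<close> of \<open>z\<close> is a nonzero
  vector of \<open>Im A = Im (A A\<^sup>T)\<close> with \<open>A *v (w ^ 3) = 0\<close>. Under (1) such a \<open>w\<close> would be orthogonal to
  \<open>w ^ 3\<close>; under (2) \<open>z\<close> would be a multiple of \<open>w\<close> and hence bounded; (6) needs the next order of the
  expansion around \<open>w\<close>. Condition (3) is treated coordinate by coordinate, (4) by conjugation with
  \<open>D\<^sup>3\<close>, and (5) by pairing the bounded quantity with \<open>\<zeta> * z\<close>.\<close>

section \<open>Coordinatewise products and cubes of vectors\<close>

lemma vec_cube_nth [simp]: "((x::'a::monoid_mult^'n) ^ 3) $ i = (x $ i) ^ 3"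
  by (simp add: power3_eq_cube)

lemma norm_vec_mult_le: "norm ((x::real^'n) * y) \<le> norm x * norm y"
proof -
  have "norm (x * y) \<le> norm (norm x *\<^sub>R y)"
    by (rule norm_le_componentwise_cart) (simp add: abs_mult mult_right_mono component_le_norm_cart)
  then show ?thesis by simp
qed

lemma norm_vec_cube_le: "norm ((x::real^'n) ^ 3) \<le> norm x ^ 3"
proof -
  have "norm (x * x * x) \<le> norm (x * x) * norm x" by (rule norm_vec_mult_le)
  also have "\<dots> \<le> norm x * norm x * norm x"
    by (intro mult_right_mono norm_vec_mult_le norm_ge_zero)
  finally show ?thesis by (simp add: power3_eq_cube)
qed

lemma vec_cube_scaleR: "(c *\<^sub>R (x::real^'n)) ^ 3 = c ^ 3 *\<^sub>R x ^ 3"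
  by (simp add: vec_eq_iff power_mult_distrib)

lemma tendsto_vec_cube:
  assumes "(f \<longlongrightarrow> (l::real^'n)) F"
  shows "((\<lambda>x. f x ^ 3) \<longlongrightarrow> l ^ 3) F"
  by (rule vec_tendstoI) (auto intro!: tendsto_intros assms)

lemma tendsto_vec_mult:
  assumes "(f \<longlongrightarrow> (l::real^'n)) F" "(g \<longlongrightarrow> m) F"
  shows "((\<lambda>x. f x * g x) \<longlongrightarrow> l * m) F"
  by (rule vec_tendstoI) (auto intro!: tendsto_intros assms)

section \<open>Image and kernel of \<open>A ** transpose A\<close>\<close>

lemma inner_mat_mult: "x \<bullet> (A *v y) = (transpose A *v x) \<bullet> (y::real^'n)" for A :: "real^'n^'m"
  by (simp add: dot_lmul_matrix)

lemma subspace_mat_im: "subspace (mat_im (A::real^'n^'m))"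
  unfolding mat_im_def by (rule linear_subspace_image) auto

text \<open>Only the component of a vector in the image of \<open>transpose A\<close> survives under
  \<open>A\<close>, because the orthogonal complement of that image is the kernel of
  \<open>A\<close>. This turns conditions on \<open>mat_im (A ** transpose A)\<close> into
  conditions on \<open>mat_im A\<close>.\<close>

lemma mat_im_mult_transpose: "mat_im (A ** transpose A) = mat_im (A::real^'n^'m)"
proof
  show "mat_im (A ** transpose A) \<subseteq> mat_im A"
    unfolding mat_im_def by (auto simp flip: matrix_vector_mul_assoc)
  have "A *v x \<in> mat_im (A ** transpose A)" for x
  proof -
    have sub: "subspace (mat_im (transpose A))" by (rule subspace_mat_im)
    obtain y z where y: "y \<in> span (mat_im (transpose A))"
      and z: "\<And>w. w \<in> span (mat_im (transpose A)) \<Longrightarrow> orthogonal z w" and x: "x = y + z"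
      using orthogonal_subspace_decomp_exists by metis
    \<comment> \<open>Tested against this vector, orthogonality says that the squared norm of
      \<open>A *v z\<close> is zero.\<close>
    have "orthogonal z (transpose A *v (A *v z))"
      by (rule z, rule span_base) (unfold mat_im_def, rule rangeI)
    then have "(A *v z) \<bullet> (A *v z) = 0"
      by (simp add: orthogonal_def inner_mat_mult inner_commute del: inner_eq_zero_iff)
    then have "A *v z = 0" by simp
    moreover have "y \<in> mat_im (transpose A)"
      using y span_eq_iff sub by metis
    then obtain v where "y = transpose A *v v" unfolding mat_im_def by blast
    ultimately have "A *v x = (A ** transpose A) *v v"
      by (simp add: x matrix_vector_right_distrib flip: matrix_vector_mul_assoc)
    then show ?thesis unfolding mat_im_def by blast
  qed
  then show "mat_im A \<subseteq> mat_im (A ** transpose A)"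
    unfolding mat_im_def by auto
qed

lemma mat_ker_mult_transpose: "mat_ker (A ** transpose A) = mat_ker (transpose (A::real^'n^'m))"
proof -
  have "transpose A *v x = 0" if "A *v (transpose A *v x) = 0" for x
  proof -
    have "(transpose A *v x) \<bullet> (transpose A *v x) = x \<bullet> (A *v (transpose A *v x))"
      by (simp only: inner_mat_mult)
    with that show ?thesis by simp
  qed
  then show ?thesis
    unfolding mat_ker_def
    by (auto simp del: transpose_matrix_vector simp flip: matrix_vector_mul_assoc)
qed

section \<open>Properness criteria and escaping sequences\<close>

lemma continuous_cubic_map: "continuous_on UNIV (cubic_map A)"
  unfolding cubic_map_def continuous_on_def
  by (auto intro!: tendsto_intros tendsto_vec_cube bounded_linear.tendsto[OF matrix_vector_mul_bounded_linear])

text \<open>Since \<open>x = cubic_map A x - (A *v x) ^ 3\<close>, a bound on \<open>A *v x\<close>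
  also bounds \<open>x\<close>. Preimages of compact sets are then bounded, and they are closed by
  continuity.\<close>

lemma proper_cubic_mapI:
  assumes "\<And>M. \<exists>N. \<forall>x. norm (cubic_map A x) \<le> M \<longrightarrow> norm (A *v x) \<le> N"
  shows "proper (cubic_map A)"
  unfolding proper_def
proof (intro allI impI)
  fix K :: "(real^'a) set" assume K: "compact K"
  obtain M where M: "\<And>y. y \<in> K \<Longrightarrow> norm y \<le> M"
    using compact_imp_bounded[OF K] unfolding bounded_iff by blast
  obtain N where N: "\<And>x. norm (cubic_map A x) \<le> M \<Longrightarrow> norm (A *v x) \<le> N"
    using assms by blast
  have "norm x \<le> M + N ^ 3" if "x \<in> cubic_map A -` K" for x
  proof -
    have F: "norm (cubic_map A x) \<le> M" using that M by simp
    have "x = cubic_map A x - (A *v x) ^ 3" by (simp add: cubic_map_def)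
    then have "norm x \<le> norm (cubic_map A x) + norm ((A *v x) ^ 3)"
      by (metis norm_triangle_ineq4)
    also have "norm ((A *v x) ^ 3) \<le> norm (A *v x) ^ 3" by (rule norm_vec_cube_le)
    also have "\<dots> \<le> N ^ 3" using N[OF F] by (intro power_mono) auto
    finally show ?thesis using F by simp
  qed
  then have "bounded (cubic_map A -` K)" unfolding bounded_iff by blast
  moreover have "closed (cubic_map A -` K)"
    using closed_vimage[OF compact_imp_closed[OF K] continuous_cubic_map] .
  ultimately show "compact (cubic_map A -` K)" by (simp add: compact_eq_bounded_closed)
qed

lemma cubic_map_image_eq: "A *v x + A *v ((A *v x) ^ 3) = A *v (cubic_map A x)"
  by (simp add: cubic_map_def matrix_vector_right_distrib)

lemma bounded_mat_mult:
  fixes A :: "real^'n^'m"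
  obtains K where "K > 0" "\<And>x. norm (A *v x) \<le> K * norm x"
  using bounded_linear.pos_bounded[OF matrix_vector_mul_bounded_linear[of A]]
  by (metis mult.commute)

text \<open>The directions of \<open>z\<close> lie on the compact unit sphere, so a subsequence
  converges, and its limit stays in the closed subspace \<open>mat_im A\<close>. The cube is
  homogeneous of degree three, so dividing the equation by \<open>norm (z k) ^ 3\<close> leaves only
  \<open>A *v (w ^ 3)\<close> in the limit.\<close>

lemma not_proper_cubic_map_sequence:
  fixes A :: "real^'n^'n"
  assumes "\<not> proper (cubic_map A)"
  obtains z b :: "nat \<Rightarrow> real^'n" and M w where
    "\<And>k. z k \<in> mat_im A" "filterlim (\<lambda>k. norm (z k)) at_top sequentially"
    "\<And>k. norm (b k) \<le> M" "\<And>k. z k + A *v (z k ^ 3) = b k"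
    "(\<lambda>k. z k /\<^sub>R norm (z k)) \<longlonglongrightarrow> w" "norm w = 1" "w \<in> mat_im A" "A *v (w ^ 3) = 0"
proof -
  obtain M where *: "\<And>N. \<exists>x. norm (cubic_map A x) \<le> M \<and> N < norm (A *v x)"
    using assms proper_cubic_mapI[of A] by (metis not_le)
  \<comment> \<open>The summand 1 keeps the norms above 1, which permits normalising;
    \<open>real k\<close> forces divergence, also along a subsequence because
    \<open>k \<le> r k\<close>.\<close>
  obtain x where x: "\<And>k. norm (cubic_map A (x k)) \<le> M"
    "\<And>k. real k + 1 < norm (A *v x k)"
    using *[of "real k + 1" for k] by metis
  define z' where "z' k = A *v x k" for k
  have "compact (sphere (0::real^'n) 1)" by simp
  moreover have "\<forall>k. z' k /\<^sub>R norm (z' k) \<in> sphere 0 1"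
  proof
    fix k have "z' k \<noteq> 0" using x(2)[of k] by (auto simp: z'_def)
    then show "z' k /\<^sub>R norm (z' k) \<in> sphere 0 1" by simp
  qed
  ultimately obtain w r where w: "w \<in> sphere 0 1" and r: "strict_mono (r::nat\<Rightarrow>nat)"
    and lim': "((\<lambda>k. z' k /\<^sub>R norm (z' k)) \<circ> r) \<longlonglongrightarrow> w"
    unfolding compact_def by meson
  obtain K where K: "K > 0" "\<And>x. norm (A *v x) \<le> K * norm x" by (rule bounded_mat_mult[of A]) blast
  define z where "z k = z' (r k)" for k
  define b where "b k = A *v cubic_map A (x (r k))" for k
  have im: "z k \<in> mat_im A" for k by (simp add: z_def z'_def mat_im_def)
  have big: "norm (z k) \<ge> real k + 1" for k
  proof -
    have "real k \<le> real (r k)" using r by (simp add: seq_suble)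
    then show ?thesis using x(2)[of "r k"] by (simp add: z_def z'_def)
  qed
  then have "real k \<le> norm (z k)" for k by (meson add_increasing2 le_add_same_cancel1 order_trans zero_le_one)
  then have top: "filterlim (\<lambda>k. norm (z k)) at_top sequentially"
    by (intro filterlim_at_top_mono[OF filterlim_real_sequentially]) simp
  have b: "norm (b k) \<le> K * M" for k
    using K x(1)[of "r k"] unfolding b_def by (meson mult_left_mono less_imp_le order_trans)
  have eq: "z k + A *v (z k ^ 3) = b k" for k
    by (simp add: z_def z'_def b_def cubic_map_image_eq)
  have lim: "(\<lambda>k. z k /\<^sub>R norm (z k)) \<longlonglongrightarrow> w"
    using lim' by (simp add: z_def o_def)
  have wim: "w \<in> mat_im A"
  proof (rule closed_sequentially[OF closed_subspace[OF subspace_mat_im] _ lim])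
    show "\<And>k. z k /\<^sub>R norm (z k) \<in> mat_im A"
      using im subspace_mat_im by (blast intro: subspace_scale)
  qed
  have "(\<lambda>k. A *v ((z k /\<^sub>R norm (z k)) ^ 3)) \<longlonglongrightarrow> A *v (w ^ 3)"
    by (intro bounded_linear.tendsto[OF matrix_vector_mul_bounded_linear] tendsto_vec_cube lim)
  \<comment> \<open>The vector \<open>A *v (z k ^ 3) = b k - z k\<close> grows at most linearly in
    \<open>norm (z k)\<close>, so division by the cube makes it decay; the crude rate
    \<open>inverse (norm (z k))\<close> suffices.\<close>
  moreover have "(\<lambda>k. A *v ((z k /\<^sub>R norm (z k)) ^ 3)) \<longlonglongrightarrow> 0"
  proof (rule Lim_null_comparison)
    have "((\<lambda>k. inverse (norm (z k))) \<longlongrightarrow> 0) sequentially"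
      by (rule tendsto_inverse_0_at_top[OF top])
    then show "(\<lambda>k. (K * M + 1) * inverse (norm (z k))) \<longlonglongrightarrow> 0"
      using tendsto_mult_right_zero by blast
    show "\<forall>\<^sub>F k in sequentially. norm (A *v ((z k /\<^sub>R norm (z k)) ^ 3)) \<le> (K * M + 1) * inverse (norm (z k))"
    proof (rule always_eventually, rule allI)
      fix k
      let ?n = "norm (z k)"
      have n: "?n \<ge> 1" using big[of k] by simp
      have KM: "K * M \<ge> 0" using b[of k] norm_ge_zero order_trans by blast
      have "A *v (z k ^ 3) = b k - z k" using eq[of k] by (simp add: algebra_simps)
      then have "norm (A *v ((z k /\<^sub>R ?n) ^ 3)) = norm (b k - z k) / ?n ^ 3"
        by (simp add: vec_cube_scaleR matrix_vector_mult_scaleR divide_inverse mult.commute power_inverse)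
      also have "\<dots> \<le> (K * M + ?n) / ?n ^ 3"
        using norm_triangle_ineq4[of "b k" "z k"] b[of k] by (intro divide_right_mono) auto
      also have "\<dots> \<le> ((K * M + 1) * ?n ^ 2) / ?n ^ 3"
      proof (intro divide_right_mono)
        have "?n \<le> ?n ^ 2" using n by (rule self_le_power) simp
        moreover have "K * M * 1 \<le> K * M * ?n ^ 2"
          using KM n by (intro mult_left_mono) auto
        ultimately show "K * M + ?n \<le> (K * M + 1) * ?n ^ 2" by (simp add: algebra_simps)
      qed auto
      also have "\<dots> = (K * M + 1) * inverse ?n"
      proof -
        have "t * s ^ 2 / s ^ 3 = t * inverse s" if "s \<noteq> 0" for s t :: real
          using that by (simp add: field_simps eval_nat_numeral)
        moreover have "?n \<noteq> 0" using n by linarith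
        ultimately show ?thesis .
      qed
      finally show "norm (A *v ((z k /\<^sub>R ?n) ^ 3)) \<le> (K * M + 1) * inverse ?n" .
    qed
  qed
  ultimately have "A *v (w ^ 3) = 0" by (rule LIMSEQ_unique)
  then show ?thesis using that[OF im top b eq lim _ wim] w by auto
qed

text \<open>A limit direction of an escaping sequence would be a unit vector satisfying both
  premises. This serves the kernel inclusion and the map for \<open>- A\<close>.\<close>

lemma proper_cubic_map_if_trivial_cube_kernel:
  assumes "\<And>w. w \<in> mat_im A \<Longrightarrow> A *v (w ^ 3) = 0 \<Longrightarrow> w = 0"
  shows "proper (cubic_map A)"
proof (rule ccontr)
  assume "\<not> proper (cubic_map A)"
  then obtain w where "norm w = 1" "w \<in> mat_im A" "A *v (w ^ 3) = 0"
    by (rule not_proper_cubic_map_sequence)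
  with assms[of w] show False by simp
qed

section \<open>Kernel inclusion and rank one\<close>

lemma inner_cube_self_eq_0:
  assumes "(w::real^'n) \<bullet> w ^ 3 = 0"
  shows "w = 0"
proof -
  from assms have "(\<Sum>i\<in>UNIV. (w $ i) ^ 4) = 0"
    by (simp add: inner_vec_def power3_eq_cube power4_eq_xxxx mult.assoc)
  then have "\<forall>i. (w $ i) ^ 4 = 0" by (subst (asm) sum_nonneg_eq_0_iff) auto
  then show "w = 0" by (simp add: vec_eq_iff)
qed

text \<open>The inclusion makes \<open>transpose A\<close> kill \<open>w ^ 3\<close>. Writing
  \<open>w = A *v v\<close>, the inner product of \<open>w ^ 3\<close> and \<open>w\<close> equals
  that of \<open>transpose A *v (w ^ 3)\<close> and \<open>v\<close>, hence is zero.\<close>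

lemma proper_cubic_map_ker:
  assumes "mat_ker A \<subseteq> mat_ker (A ** transpose A)"
  shows "proper (cubic_map A)"
proof (rule proper_cubic_map_if_trivial_cube_kernel)
  fix w assume w: "w \<in> mat_im A" "A *v (w ^ 3) = 0"
  then have "transpose A *v (w ^ 3) = 0"
    using assms unfolding mat_ker_mult_transpose by (auto simp: mat_ker_def)
  moreover obtain v where v: "w = A *v v" using w unfolding mat_im_def by blast
  ultimately have "w ^ 3 \<bullet> w = 0" by (simp add: v inner_mat_mult)
  then show "w = 0" by (intro inner_cube_self_eq_0) (simp add: inner_commute)
qed

text \<open>The image of \<open>A\<close> is the line through \<open>w\<close>, on which
  \<open>A *v (z ^ 3)\<close> vanishes, so \<open>z k = b k\<close> would stay bounded.\<close>

lemma proper_cubic_map_rank_1: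
  assumes "rank (A ** transpose A) = 1"
  shows "proper (cubic_map A)"
proof (rule ccontr)
  assume "\<not> proper (cubic_map A)"
  then obtain z b :: "nat \<Rightarrow> real^'a" and M w where
    z: "\<And>k. z k \<in> mat_im A" "filterlim (\<lambda>k. norm (z k)) at_top sequentially"
    "\<And>k. norm (b k) \<le> M" "\<And>k. z k + A *v (z k ^ 3) = b k"
    and w: "norm w = 1" "w \<in> mat_im A" "A *v (w ^ 3) = 0"
    by (rule not_proper_cubic_map_sequence) blast
  have "dim (mat_im A) = 1"
    using assms mat_im_mult_transpose[of A] by (simp add: rank_dim_range mat_im_def)
  then have "mat_im A \<subseteq> span {w}"
    using w by (intro card_ge_dim_independent) auto
  then have "norm (z k) \<le> M" for k
  proof -
    obtain c where "z k = c *\<^sub>R w"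
      using z(1)[of k] \<open>mat_im A \<subseteq> span {w}\<close> by (auto simp: span_singleton)
    then have "A *v (z k ^ 3) = 0"
      using w by (simp add: vec_cube_scaleR matrix_vector_mult_scaleR)
    then show ?thesis using z(3,4)[of k] by simp
  qed
  moreover obtain k where "norm (z k) > M"
    using eventually_happens[OF z(2)[unfolded filterlim_at_top_dense, rule_format, of M]] by auto
  ultimately show False by (meson not_le)
qed

section \<open>Triangular matrices\<close>

text \<open>This is one row of a triangular system, with \<open>b\<close> collecting the coordinates
  already controlled. With \<open>s = a * x + b\<close>, eliminating \<open>x\<close> gives
  \<open>a * s ^ 3 + s = a * c + b\<close>, where the cubic term dominates if
  \<open>a \<noteq> 0\<close>.\<close>

lemma cubic_coordinate_bound:
  fixes a :: real
  shows "\<exists>N. \<forall>x b c. \<bar>b\<bar> \<le> B \<longrightarrow> \<bar>c\<bar> \<le> C \<longrightarrow> x + (a * x + b) ^ 3 = c \<longrightarrow> \<bar>x\<bar> \<le> N"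
proof -
  \<comment> \<open>For \<open>a = 0\<close> simply \<open>s = b\<close>. Otherwise the leading
    summand 1 covers \<open>\<bar>s\<bar> \<le> 1\<close>, and the quotient is the bound for larger
    \<open>s\<close>.\<close>
  define S where "S = (if a = 0 then B else 1 + (1 + (B + \<bar>a\<bar> * C)) / \<bar>a\<bar>)"
  have "\<bar>x\<bar> \<le> C + S ^ 3"
    if b: "\<bar>b\<bar> \<le> B" and c: "\<bar>c\<bar> \<le> C" and eq: "x + (a * x + b) ^ 3 = c" for x b c
  proof -
    define s where "s = a * x + b"
    have BC: "B \<ge> 0" "C \<ge> 0" using b c by auto
    have "\<bar>s\<bar> \<le> S"
    proof (cases "a = 0 \<or> \<bar>s\<bar> \<le> 1")
      case True
      moreover have "0 \<le> (1 + (B + \<bar>a\<bar> * C)) / \<bar>a\<bar>" using BC by simp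
      ultimately show ?thesis using True b by (cases "a = 0") (auto simp: S_def s_def simp del: zero_le_divide_abs_iff)
    next
      case False
      then have a: "\<bar>a\<bar> > 0" and s: "\<bar>s\<bar> > 1" by auto
      have "x = c - s ^ 3" using eq by (simp add: s_def)
      then have "a * s ^ 3 = a * c - a * x" by (simp add: right_diff_distrib)
      then have "a * s ^ 3 = a * c + b - s" by (simp add: s_def)
      then have "\<bar>a\<bar> * \<bar>s\<bar> ^ 3 = \<bar>a * c + b - s\<bar>" by (simp flip: abs_mult power_abs)
      also have "\<dots> \<le> \<bar>a\<bar> * C + B + \<bar>s\<bar>"
        using b mult_left_mono[OF c, of "\<bar>a\<bar>"] by (simp add: abs_mult[symmetric])
      also have "\<dots> \<le> (1 + (B + \<bar>a\<bar> * C)) * \<bar>s\<bar>"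
        using s BC mult_left_mono[of 1 "\<bar>s\<bar>" "B + \<bar>a\<bar> * C"] by (simp add: algebra_simps)
      finally have "(\<bar>a\<bar> * \<bar>s\<bar> ^ 2) * \<bar>s\<bar> \<le> (1 + (B + \<bar>a\<bar> * C)) * \<bar>s\<bar>"
        by (simp add: power2_eq_square power3_eq_cube mult.assoc)
      then have "\<bar>a\<bar> * \<bar>s\<bar> ^ 2 \<le> 1 + (B + \<bar>a\<bar> * C)"
        using s by (subst (asm) mult_le_cancel_right) auto
      \<comment> \<open>As \<open>\<bar>s\<bar> > 1\<close>, the quadratic estimate yields a linear
        one, which avoids a square root in \<open>S\<close>.\<close>
      moreover have "\<bar>a\<bar> * \<bar>s\<bar> \<le> \<bar>a\<bar> * \<bar>s\<bar> ^ 2"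
        using s by (intro mult_left_mono self_le_power) auto
      ultimately have "\<bar>s\<bar> * \<bar>a\<bar> \<le> 1 + (B + \<bar>a\<bar> * C)" by (simp only: mult.commute)
      then have "\<bar>s\<bar> \<le> (1 + (B + \<bar>a\<bar> * C)) / \<bar>a\<bar>"
        using a by (simp only: pos_le_divide_eq)
      then show ?thesis using a by (simp add: S_def)
    qed
    then have "\<bar>s ^ 3\<bar> \<le> S ^ 3" unfolding power_abs by (intro power_mono) auto
    then show ?thesis using eq c unfolding s_def by linarith
  qed
  then show ?thesis by blast
qed

text \<open>Triangularity with respect to an arbitrary well-founded order of the coordinates covers the
  upper and the lower case at once.\<close>

lemma proper_cubic_map_triangular:
  fixes A :: "real^'n^'n"
  assumes "wf r" and A: "\<And>i j. A $ i $ j \<noteq> 0 \<Longrightarrow> i \<noteq> j \<Longrightarrow> (j, i) \<in> r"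
  shows "proper (cubic_map A)"
proof (rule proper_cubic_mapI)
  fix M
  have "\<exists>N. \<forall>x. norm (cubic_map A x) \<le> M \<longrightarrow> \<bar>x $ i\<bar> \<le> N" for i
    using \<open>wf r\<close>
  proof (induction i rule: wf_induct_rule)
    case (less i)
    then have "\<forall>j. \<exists>N. A $ i $ j \<noteq> 0 \<longrightarrow> i \<noteq> j \<longrightarrow> (\<forall>x. norm (cubic_map A x) \<le> M \<longrightarrow> \<bar>x $ j\<bar> \<le> N)"
      using A by blast
    then obtain N where N: "\<And>j x. A $ i $ j \<noteq> 0 \<Longrightarrow> i \<noteq> j \<Longrightarrow> norm (cubic_map A x) \<le> M \<Longrightarrow> \<bar>x $ j\<bar> \<le> N j"
      by metis
    \<comment> \<open>Where \<open>A $ i $ j = 0\<close>, nothing is known about \<open>N j\<close>,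
      but its contribution is multiplied by zero.\<close>
    define B where "B = (\<Sum>j\<in>UNIV - {i}. \<bar>A $ i $ j\<bar> * N j)"
    obtain N' where N': "\<And>x b c. \<bar>b\<bar> \<le> B \<Longrightarrow> \<bar>c\<bar> \<le> M \<Longrightarrow> x + (A $ i $ i * x + b) ^ 3 = c \<Longrightarrow> \<bar>x\<bar> \<le> N'"
      using cubic_coordinate_bound[of B M "A $ i $ i"] by blast
    have "\<bar>x $ i\<bar> \<le> N'" if x: "norm (cubic_map A x) \<le> M" for x
    proof (rule N')
      define b where "b = (\<Sum>j\<in>UNIV - {i}. A $ i $ j * x $ j)"
      have "\<bar>A $ i $ j * x $ j\<bar> \<le> \<bar>A $ i $ j\<bar> * N j" if "j \<in> UNIV - {i}" for j
        using N[of j x] x that by (cases "A $ i $ j = 0") (auto simp: abs_mult intro: mult_left_mono)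
      then show "\<bar>b\<bar> \<le> B" unfolding b_def B_def
        by (intro order_trans[OF sum_abs] sum_mono)
      show "\<bar>cubic_map A x $ i\<bar> \<le> M" using component_le_norm_cart x order_trans by blast
      have "(A *v x) $ i = A $ i $ i * x $ i + b"
        unfolding matrix_vector_mult_def b_def by (simp add: sum.remove[of UNIV i])
      then show "x $ i + (A $ i $ i * x $ i + b) ^ 3 = cubic_map A x $ i"
        by (simp add: cubic_map_def)
    qed
    then show ?case by blast
  qed
  then obtain N where N: "\<And>i x. norm (cubic_map A x) \<le> M \<Longrightarrow> \<bar>x $ i\<bar> \<le> N i" by metis
  obtain K where K: "K > 0" "\<And>x. norm (A *v x) \<le> K * norm x" by (rule bounded_mat_mult[of A]) blast
  have "norm (A *v x) \<le> K * (\<Sum>i\<in>UNIV. N i)" if x: "norm (cubic_map A x) \<le> M" for x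
  proof -
    have "norm x \<le> (\<Sum>i\<in>UNIV. N i)"
      using norm_le_l1_cart[of x] sum_mono[of UNIV "\<lambda>i. \<bar>x $ i\<bar>" N] N[OF x] by simp
    then show ?thesis using K by (meson mult_left_mono less_imp_le order_trans)
  qed
  then show "\<exists>N. \<forall>x. norm (cubic_map A x) \<le> M \<longrightarrow> norm (A *v x) \<le> N" by blast
qed

section \<open>Conjugation by diagonal matrices\<close>

lemma diagonal_matrix_mult_vec:
  assumes "diagonal_matrix D" shows "D *v x = (\<chi> i. D $ i $ i) * x"
proof -
  have "(\<Sum>j\<in>UNIV. D $ i $ j * x $ j) = D $ i $ i * x $ i" for i
    using assms by (subst sum.remove[of UNIV i]) (auto simp: diagonal_matrix_def)
  then show ?thesis by (simp add: vec_eq_iff matrix_vector_mult_def)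
qed

text \<open>With \<open>T\<close> the matrix cube of \<open>D\<close>, applying \<open>T\<close> and
  then \<open>cubic_map B\<close> is the same as applying \<open>cubic_map A\<close> and then
  \<open>T\<close>. Preimages of compact sets under the two maps therefore correspond under the
  linear isomorphism \<open>T\<close>, whose inverse is \<open>E\<close>.\<close>

lemma proper_cubic_map_conjugate:
  fixes A D :: "real^'n^'n"
  assumes D: "diagonal_matrix D" "invertible D"
    and proper: "proper (cubic_map (D ** A ** (matrix_inv D ** matrix_inv D ** matrix_inv D)))"
  shows "proper (cubic_map A)"
  unfolding proper_def
proof (intro allI impI)
  fix K :: "(real^'n) set" assume K: "compact K"
  define B where "B = D ** A ** (matrix_inv D ** matrix_inv D ** matrix_inv D)"
  define E where "E = matrix_inv D ** matrix_inv D ** matrix_inv D"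
  define T where "T = D ** D ** D"
  have inv: "D ** matrix_inv D = mat 1" "matrix_inv D ** D = mat 1"
    using someI_ex[OF D(2)[unfolded invertible_def]] unfolding matrix_inv_def by blast+
  then have DD: "D *v (matrix_inv D *v x) = x" "matrix_inv D *v (D *v x) = x" for x
    by (simp_all add: matrix_vector_mul_assoc)
  have ET: "E *v (T *v x) = x" "T *v (E *v x) = x" for x
    by (simp_all add: E_def T_def DD flip: matrix_vector_mul_assoc)
  \<comment> \<open>A diagonal matrix multiplies coordinatewise by a vector, so the three factors
    \<open>D\<close> can be distributed over the three factors of the cube.\<close>
  have T3: "T *v (x ^ 3) = (D *v x) ^ 3" for x
    by (simp add: T_def diagonal_matrix_mult_vec[OF D(1)] power3_eq_cube ac_simps flip: matrix_vector_mul_assoc)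
  have B: "cubic_map B (T *v x) = T *v cubic_map A x" for x
  proof -
    have "B *v (T *v x) = D *v (A *v x)"
      using ET(1)[of x] by (simp add: B_def flip: E_def matrix_vector_mul_assoc)
    then show ?thesis by (simp add: cubic_map_def matrix_vector_right_distrib T3)
  qed
  have lin: "continuous_on S ((*v) C)" for S and C :: "real^'n^'n"
    by (rule linear_continuous_on) simp
  have "compact (cubic_map B -` ((*v) T ` K))"
    using proper K lin unfolding proper_def B_def by (blast intro: compact_continuous_image)
  then have "compact ((*v) E ` (cubic_map B -` ((*v) T ` K)))"
    using lin compact_continuous_image by blast
  moreover have "(*v) E ` (cubic_map B -` ((*v) T ` K)) = cubic_map A -` K"
  proof
    show "(*v) E ` (cubic_map B -` ((*v) T ` K)) \<subseteq> cubic_map A -` K"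
    proof safe
      fix x k assume "cubic_map B x = T *v k" "k \<in> K"
      then have "T *v cubic_map A (E *v x) = T *v k" using B[of "E *v x"] by (simp add: ET)
      then have "cubic_map A (E *v x) = k" using ET(1) by metis
      then show "E *v x \<in> cubic_map A -` K" using \<open>k \<in> K\<close> by simp
    qed
    show "cubic_map A -` K \<subseteq> (*v) E ` (cubic_map B -` ((*v) T ` K))"
    proof
      fix x assume "x \<in> cubic_map A -` K"
      then show "x \<in> (*v) E ` (cubic_map B -` ((*v) T ` K))"
        by (intro image_eqI[of _ _ "T *v x"]) (auto simp: ET B)
    qed
  qed
  ultimately show "compact (cubic_map A -` K)" by simp
qed

section \<open>Positivity of a weighted pairing\<close>

lemma weighted_inner_ge:
  fixes \<zeta> :: "real^'n"
  assumes "\<And>i. \<zeta> $ i > 0"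
  obtains c where "c > 0" "\<And>x. x \<bullet> (\<zeta> * x) \<ge> c * norm x ^ 2"
proof -
  define c where "c = Min (range (($) \<zeta>))"
  have "c > 0" unfolding c_def by (subst Min_gr_iff) (auto simp: assms)
  have c: "c \<le> \<zeta> $ i" for i unfolding c_def by (rule Min_le) auto
  have "x \<bullet> (\<zeta> * x) \<ge> c * norm x ^ 2" for x
  proof -
    have "c * (x \<bullet> x) = (\<Sum>i\<in>UNIV. c * (x $ i) ^ 2)"
      by (simp add: inner_vec_def sum_distrib_left power2_eq_square)
    also have "\<dots> \<le> (\<Sum>i\<in>UNIV. \<zeta> $ i * (x $ i) ^ 2)"
      by (intro sum_mono mult_right_mono c) auto
    also have "\<dots> = x \<bullet> (\<zeta> * x)"
      by (simp add: inner_vec_def power2_eq_square ac_simps)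
    finally show ?thesis by (simp add: power2_norm_eq_inner)
  qed
  with \<open>c > 0\<close> show ?thesis by (rule that)
qed

text \<open>When \<open>z + A *v (z ^ 3) = A *v cubic_map A x\<close> is paired with
  \<open>\<zeta> * z\<close>, the cubic term is nonnegative. The left side is then at least a
  positive multiple of \<open>norm z ^ 2\<close>, the right side at most a multiple of
  \<open>norm z\<close>.\<close>

lemma proper_cubic_map_weighted_inner:
  fixes A :: "real^'n^'n"
  assumes "\<And>i. \<zeta> $ i > 0" and A: "\<And>x. x \<in> mat_im A \<Longrightarrow> (A *v (x ^ 3)) \<bullet> (\<zeta> * x) \<ge> 0"
  shows "proper (cubic_map A)"
proof (rule proper_cubic_mapI)
  fix M
  obtain c where c: "c > 0" "\<And>x. x \<bullet> (\<zeta> * x) \<ge> c * norm x ^ 2"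
    using weighted_inner_ge assms(1) by blast
  obtain K where K: "K > 0" "\<And>x. norm (A *v x) \<le> K * norm x" by (rule bounded_mat_mult[of A]) blast
  have "norm (A *v x) \<le> K * M * norm \<zeta> / c" if x: "norm (cubic_map A x) \<le> M" for x
  proof (cases "A *v x = 0")
    case True
    have "0 \<le> M" using x norm_ge_zero order_trans by blast
    then show ?thesis using True K c by simp
  next
    case False
    define z where "z = A *v x"
    have "c * norm z ^ 2 \<le> z \<bullet> (\<zeta> * z) + (A *v (z ^ 3)) \<bullet> (\<zeta> * z)"
      using c(2)[of z] A[of z] by (simp add: z_def mat_im_def)
    also have "\<dots> = (A *v cubic_map A x) \<bullet> (\<zeta> * z)"
      by (simp add: z_def flip: cubic_map_image_eq inner_add_left)
    also have "\<dots> \<le> norm (A *v cubic_map A x) * norm (\<zeta> * z)" by (rule norm_cauchy_schwarz)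
    also have "\<dots> \<le> (K * M) * (norm \<zeta> * norm z)"
    proof (intro mult_mono norm_vec_mult_le)
      show "norm (A *v cubic_map A x) \<le> K * M"
        using K x by (meson mult_left_mono less_imp_le order_trans)
      then show "0 \<le> K * M" using norm_ge_zero order_trans by blast
    qed auto
    finally have "(c * norm z) * norm z \<le> (K * M * norm \<zeta>) * norm z"
      by (simp add: power2_eq_square mult.assoc)
    then have "c * norm z \<le> K * M * norm \<zeta>"
      using False by (subst (asm) mult_le_cancel_right) (auto simp: z_def)
    then show ?thesis using c(1) by (simp add: field_simps z_def)
  qed
  then show "\<exists>N. \<forall>x. norm (cubic_map A x) \<le> M \<longrightarrow> norm (A *v x) \<le> N" by blast
qed

section \<open>Kernel spanned by the vector \<open>1\<close>\<close>

text \<open>Expanding the sequence as \<open>z = s *\<^sub>R (1 + e)\<close>, where \<open>e\<close> vanishes in one coordinate, and using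
  \<open>A *v 1 = 0\<close>, the leading part of the equation divided by \<open>s\<close> is \<open>1 + A *v (3 s\<^sup>2 e) \<rightarrow> 0\<close>, so that
  \<open>1\<close> lies in the closed subspace \<open>A (Im A)\<close>.\<close>

lemma proper_cubic_map_ker_span_1:
  fixes A :: "real^'n^'n"
  assumes ker: "mat_ker A = span {1}"
    and one: "1 \<notin> mat_im (A ** transpose A) \<inter> mat_im (A ** A ** transpose A)"
  shows "proper (cubic_map A)"
proof (rule ccontr)
  assume "\<not> proper (cubic_map A)"
  then obtain z b :: "nat \<Rightarrow> real^'n" and M w where
    z: "\<And>k. z k \<in> mat_im A" "filterlim (\<lambda>k. norm (z k)) at_top sequentially"
    and b: "\<And>k. norm (b k) \<le> M" and eq: "\<And>k. z k + A *v (z k ^ 3) = b k"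
    and lim: "(\<lambda>k. z k /\<^sub>R norm (z k)) \<longlonglongrightarrow> w"
    and w: "norm w = 1" "w \<in> mat_im A" "A *v (w ^ 3) = 0"
    by (rule not_proper_cubic_map_sequence) blast
  have A1: "A *v 1 = 0" using ker by (auto simp: mat_ker_def span_base set_eq_iff)
  have "w ^ 3 \<in> span {1}" using w ker by (auto simp: mat_ker_def)
  then obtain c where c: "w ^ 3 = c *\<^sub>R 1" by (auto simp: span_singleton)
  \<comment> \<open>All coordinates of \<open>w ^ 3\<close> coincide and real cube roots are unique,
    so \<open>w\<close> is itself a multiple of \<open>1\<close>.\<close>
  have wi: "w $ i = root 3 c" for i
  proof -
    have "(w $ i) ^ 3 = c" using arg_cong[OF c, of "\<lambda>v. v $ i"] by simp
    then show ?thesis by (metis odd_numeral odd_real_root_power_cancel)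
  qed
  \<comment> \<open>Any coordinate can serve for normalisation, since all coordinates of
    \<open>w\<close> equal the same nonzero number.\<close>
  obtain i0 :: 'n where True by simp
  define d where "d = w $ i0"
  have wd: "w = d *\<^sub>R 1" by (simp add: vec_eq_iff wi d_def)
  then have d: "d \<noteq> 0" using w(1) by auto
  \<comment> \<open>Hence \<open>one\<close> excludes \<open>1\<close> from
    \<open>mat_im (A ** A ** transpose A)\<close>, the image of \<open>mat_im A\<close> under
    \<open>A\<close>; this is what the expansion contradicts.\<close>
  have one_im: "1 \<in> mat_im A"
    using subspace_scale[OF subspace_mat_im w(2), of "inverse d"] d by (simp add: wd)

  \<comment> \<open>With \<open>s = z k $ i0\<close>, \<open>h\<close> is the first-order term of
    the cube divided by \<open>s\<close>, and \<open>\<delta>\<close> comes from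
    \<open>(1 + e) ^ 3 = 1 + 3 * e * (1 + \<delta>)\<close>. The default \<open>r k = 0\<close> for
    \<open>s = 0\<close> occurs only finitely often.\<close>
  define u where "u k = z k /\<^sub>R norm (z k)" for k
  define r where "r k = inverse (z k $ i0)" for k
  define e where "e k = r k *\<^sub>R z k - 1" for k
  define h where "h k = (3 * (z k $ i0) ^ 2) *\<^sub>R e k" for k
  define \<delta> where "\<delta> k = e k + (1/3) *\<^sub>R (e k * e k)" for k
  have ui0: "(\<lambda>k. u k $ i0) \<longlonglongrightarrow> d"
    unfolding u_def d_def by (rule tendsto_vec_nth[OF lim])
  have nz: "\<forall>\<^sub>F k in sequentially. z k $ i0 \<noteq> 0"
    using tendsto_imp_eventually_ne[OF ui0 d] by eventually_elim (auto simp: u_def)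
  have zpos: "\<forall>\<^sub>F k in sequentially. norm (z k) > 0"
    using z(2)[unfolded filterlim_at_top_dense, rule_format, of 0] .
  have "(\<lambda>k. inverse (norm (z k)) * inverse (u k $ i0)) \<longlonglongrightarrow> 0 * inverse d"
    by (intro tendsto_mult tendsto_inverse ui0 d tendsto_inverse_0_at_top[OF z(2)])
  moreover have "\<forall>\<^sub>F k in sequentially. inverse (norm (z k)) * inverse (u k $ i0) = r k"
    using zpos nz by eventually_elim (simp add: u_def r_def field_simps)
  ultimately have r0: "r \<longlonglongrightarrow> 0" by (simp add: tendsto_cong)
  have "(\<lambda>k. inverse (u k $ i0) *\<^sub>R u k - 1) \<longlonglongrightarrow> inverse d *\<^sub>R w - 1"
    using lim by (intro tendsto_intros ui0 d) (simp add: u_def)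
  moreover have "\<forall>\<^sub>F k in sequentially. inverse (u k $ i0) *\<^sub>R u k - 1 = e k"
    using zpos nz by eventually_elim (simp add: u_def e_def r_def field_simps)
  ultimately have e0: "e \<longlonglongrightarrow> 0" using d by (simp add: tendsto_cong wd)
  have \<delta>0: "\<delta> \<longlonglongrightarrow> 0"
    unfolding \<delta>_def using tendsto_add[OF e0 tendsto_scaleR[OF tendsto_const tendsto_vec_mult[OF e0 e0]]] by simp
  \<comment> \<open>This is the equation divided by \<open>s\<close>; its largest term, a multiple
    of \<open>1\<close>, is killed by \<open>A\<close>.\<close>
  have main: "\<forall>\<^sub>F k in sequentially. A *v h k + A *v (h k * \<delta> k) = r k *\<^sub>R b k - 1 - e k"
    using nz
  proof eventually_elim
    case (elim k)
    define s where "s = z k $ i0"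
    have s: "s \<noteq> 0" using elim by (simp add: s_def)
    have rz: "r k *\<^sub>R z k = 1 + e k" by (simp add: e_def)
    have "r k *\<^sub>R z k ^ 3 = (s ^ 2) *\<^sub>R 1 + (h k + h k * \<delta> k)"
    proof -
      have r: "r k = inverse s" by (simp add: r_def s_def)
      have zi: "z k $ i = s * (1 + e k $ i)" for i
        using s by (simp add: e_def r)
      have "r k * (z k $ i) ^ 3 = s ^ 2 * (1 + e k $ i) ^ 3" for i
        using s unfolding zi r by (simp add: power_mult_distrib power2_eq_square power3_eq_cube)
      then show ?thesis
        by (simp add: vec_eq_iff h_def \<delta>_def power3_eq_cube algebra_simps flip: s_def)
    qed
    then have "r k *\<^sub>R (A *v (z k ^ 3)) = A *v h k + A *v (h k * \<delta> k)"
      by (simp add: A1 matrix_vector_right_distrib matrix_vector_mult_scaleR flip: matrix_vector_mult_scaleR[of A "r k"])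
    moreover have "r k *\<^sub>R b k = 1 + e k + r k *\<^sub>R (A *v (z k ^ 3))"
      by (simp add: rz scaleR_add_right flip: eq)
    ultimately show ?case by simp
  qed
  have rb: "(\<lambda>k. r k *\<^sub>R b k) \<longlonglongrightarrow> 0"
  proof (rule Lim_null_comparison)
    show "(\<lambda>k. norm (r k) * M) \<longlonglongrightarrow> 0"
      using tendsto_mult_left_zero[OF tendsto_norm_zero[OF r0]] .
    show "\<forall>\<^sub>F k in sequentially. norm (r k *\<^sub>R b k) \<le> norm (r k) * M"
      using b by (auto intro!: always_eventually mult_left_mono)
  qed
  have rhs: "(\<lambda>k. r k *\<^sub>R b k - 1 - e k) \<longlonglongrightarrow> - 1"
    using tendsto_diff[OF tendsto_diff[OF rb tendsto_const] e0] by simp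
  have sum_lim: "(\<lambda>k. A *v h k + A *v (h k * \<delta> k)) \<longlonglongrightarrow> - 1"
    using rhs tendsto_cong[OF main] by simp

  \<comment> \<open>The hyperplane \<open>W\<close> meets the kernel only in 0, so \<open>A\<close>
    is bounded below on it. Eventually \<open>h k\<close> lies in \<open>W\<close>, so control of
    \<open>A *v h k\<close> gives control of \<open>h k\<close>.\<close>
  define W where "W = {x::real^'n. x $ i0 = 0}"
  have "subspace W" by (auto simp: W_def subspace_def)
  moreover have "\<forall>x\<in>W. A *v x = 0 \<longrightarrow> x = 0"
  proof (intro ballI impI)
    fix x assume "x \<in> W" "A *v x = 0"
    then have "x \<in> span {1}" using ker by (auto simp: mat_ker_def)
    then obtain t where "x = t *\<^sub>R 1" by (auto simp: span_singleton)
    then show "x = 0" using \<open>x \<in> W\<close> by (simp add: W_def)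
  qed
  ultimately obtain a where a: "a > 0" "\<And>x. x \<in> W \<Longrightarrow> norm (A *v x) \<ge> a * norm x"
    using injective_imp_isometric[OF closed_subspace, of W "(*v) A"] by auto
  obtain K where K: "K > 0" "\<And>x. norm (A *v x) \<le> K * norm x" by (rule bounded_mat_mult[of A]) blast
  have K\<delta>: "norm (A *v (h k * \<delta> k)) \<le> K * norm (h k) * norm (\<delta> k)" for k
    unfolding mult.assoc
    by (rule order_trans[OF K(2) mult_left_mono[OF norm_vec_mult_le]]) (use K(1) in simp)
  define C where "C = norm (-1::real^'n) + 1"
  have "\<forall>\<^sub>F k in sequentially. norm (A *v h k + A *v (h k * \<delta> k)) < C"
    using order_tendstoD(2)[OF tendsto_norm[OF sum_lim]] by (simp add: C_def)
  \<comment> \<open>Below this threshold the error term is at most half of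
    \<open>a * norm (h k)\<close> and can be absorbed on the left.\<close>
  moreover have "\<forall>\<^sub>F k in sequentially. norm (\<delta> k) < a / (2 * K)"
    using order_tendstoD(2)[OF tendsto_norm[OF \<delta>0], of "a / (2 * K)"] a K by simp
  ultimately have hb: "\<forall>\<^sub>F k in sequentially. norm (h k) \<le> 2 * C / a"
    using nz
  proof eventually_elim
    case (elim k)
    have "h k \<in> W" using elim(3) by (simp add: W_def h_def e_def r_def)
    then have "a * norm (h k) \<le> norm (A *v h k)" by (rule a(2))
    also have "\<dots> \<le> norm (A *v h k + A *v (h k * \<delta> k)) + norm (A *v (h k * \<delta> k))"
      using norm_triangle_ineq4[of "A *v h k + A *v (h k * \<delta> k)" "A *v (h k * \<delta> k)"] by simp
    also have "\<dots> \<le> C + K * norm (h k) * norm (\<delta> k)" using elim(1) K\<delta>[of k] by linarith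
    also have "K * norm (h k) * norm (\<delta> k) \<le> K * norm (h k) * (a / (2 * K))"
      using elim(2) K(1) by (intro mult_left_mono) auto
    finally have "a * norm (h k) \<le> C + a * norm (h k) / 2" using K(1) by (simp add: field_simps)
    then show ?case using a(1) by (simp add: field_simps)
  qed
  have "(\<lambda>k. A *v (h k * \<delta> k)) \<longlonglongrightarrow> 0"
  proof (rule Lim_null_comparison)
    show "(\<lambda>k. K * (2 * C / a) * norm (\<delta> k)) \<longlonglongrightarrow> 0"
      using tendsto_mult_right_zero[OF tendsto_norm_zero[OF \<delta>0]] .
    show "\<forall>\<^sub>F k in sequentially. norm (A *v (h k * \<delta> k)) \<le> K * (2 * C / a) * norm (\<delta> k)"
      using hb
    proof eventually_elim
      case (elim k)
      have "K * norm (h k) * norm (\<delta> k) \<le> K * (2 * C / a) * norm (\<delta> k)"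
        using elim K(1) by (intro mult_right_mono mult_left_mono) auto
      then show ?case using K\<delta>[of k] by linarith
    qed
  qed
  then have hlim: "(\<lambda>k. A *v h k) \<longlonglongrightarrow> - 1"
    using tendsto_diff[OF sum_lim] by force
  have sub: "subspace ((*v) A ` mat_im A)"
    by (intro linear_subspace_image subspace_mat_im) simp
  \<comment> \<open>Both \<open>z k\<close> and \<open>1\<close> lie in \<open>mat_im A\<close>, so
    the limit of \<open>A *v h k\<close> stays in the closed image of \<open>mat_im A\<close> under
    \<open>A\<close>.\<close>
  have "h k \<in> mat_im A" for k
    unfolding h_def e_def
    by (intro subspace_scale subspace_diff subspace_mat_im z one_im)
  then have "- 1 \<in> (*v) A ` mat_im A"
    by (intro closed_sequentially[OF closed_subspace[OF sub] _ hlim]) blast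
  then have "1 \<in> (*v) A ` mat_im A" using subspace_neg[OF sub, of "- 1"] by simp
  then have "1 \<in> mat_im (A ** A ** transpose A)"
    unfolding mat_im_mult_transpose[of A, symmetric]
    by (auto simp: mat_im_def simp flip: matrix_vector_mul_assoc)
  then show False using one one_im mat_im_mult_transpose[of A] by blast
qed

section \<open>Examples of the kernel inclusion and assembly of the cases\<close>

lemma mat_ker_subset_if_invertible_or_symmetric:
  fixes A :: "real^'n^'n"
  assumes "invertible A \<or> transpose A = A \<or> transpose A = - A"
  shows "mat_ker A \<subseteq> mat_ker (A ** transpose A)"
proof -
  \<comment> \<open>This suffices because \<open>A ** transpose A\<close> and
    \<open>transpose A\<close> have the same kernel.\<close>
  have "transpose A *v x = 0" if x: "A *v x = 0" for x
    using assms
  proof (elim disjE)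
    assume "invertible A"
    then have "x = 0" using x inj_matrix_vector_mult[of A] by (metis injD matrix_vector_mult_0_right)
    then show ?thesis by simp
  next
    assume "transpose A = A"
    then show ?thesis using x by (simp del: transpose_matrix_vector)
  next
    assume "transpose A = - A"
    then show ?thesis using x matrix_vector_mult_diff_rdistrib[of 0 A x]
      by (simp del: transpose_matrix_vector)
  qed
  then show ?thesis unfolding mat_ker_mult_transpose by (auto simp: mat_ker_def)
qed

lemma uminus_mat_mult: "(- A) *v x = - (A *v (x::real^'n))" for A :: "real^'n^'m"
  using matrix_vector_mult_diff_rdistrib[of 0 A x] by simp

theorem theorem1p7:
  fixes A :: "real^('n::{finite,linorder})^('n::{finite,linorder})"
  shows
    "((mat_ker A \<subseteq> mat_ker (A ** transpose A) \<or>
       rank (A ** transpose A) = 1 \<or>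
       (upper_triangular_matrix A \<or> lower_triangular_matrix A) \<or>
       (\<exists>D. diagonal_matrix D \<and> invertible D \<and>
          proper (cubic_map (D ** A ** (matrix_inv D ** matrix_inv D ** matrix_inv D)))) \<or>
       (\<exists>\<zeta>. (\<forall>i. \<zeta> $ i > 0) \<and>
          (\<forall>x \<in> mat_im (A ** transpose A). (A *v (x ^ 3)) \<bullet> (\<zeta> * x) \<ge> 0)) \<or>
       (mat_ker A = span {1} \<and>
          1 \<notin> mat_im (A ** transpose A) \<inter> mat_im (A ** A ** transpose A)))
      \<longrightarrow> proper (cubic_map A))
     \<and>
     (invertible A \<or> transpose A = A \<or> transpose A = - A
      \<longrightarrow> mat_ker A \<subseteq> mat_ker (A ** transpose A))
     \<and>
     ((\<exists>\<zeta>. (\<forall>i. \<zeta> $ i > 0) \<and>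
         (\<forall>x \<in> mat_im (A ** transpose A). (A *v (x ^ 3)) \<bullet> (\<zeta> * x) \<ge> 0) \<and>
         (\<forall>x \<in> mat_im (A ** transpose A). x \<noteq> 0 \<longrightarrow> (A *v (x ^ 3)) \<bullet> (\<zeta> * x) \<noteq> 0))
      \<longrightarrow> proper (cubic_map (- A)) \<and> cubic_map (- A) = (\<lambda>x. x - (A *v x) ^ 3))"
proof (intro conjI)
  \<comment> \<open>Off the diagonal, row \<open>i\<close> of an upper triangular matrix involves
    only indices above \<open>i\<close>, so the induction runs along the converse of
    \<open>r\<close>; in the lower case it runs along \<open>r\<close>. Finiteness makes both
    well-founded.\<close>
  define r where "r = {(j, i :: 'n). j < i}"
  have "acyclic (r\<inverse>)"
    by (rule acyclicI_order[where f = "\<lambda>i. i"]) (simp add: r_def)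
  then have acyc: "acyclic r" by simp
  show "(mat_ker A \<subseteq> mat_ker (A ** transpose A) \<or>
       rank (A ** transpose A) = 1 \<or>
       (upper_triangular_matrix A \<or> lower_triangular_matrix A) \<or>
       (\<exists>D. diagonal_matrix D \<and> invertible D \<and>
          proper (cubic_map (D ** A ** (matrix_inv D ** matrix_inv D ** matrix_inv D)))) \<or>
       (\<exists>\<zeta>. (\<forall>i. \<zeta> $ i > 0) \<and>
          (\<forall>x \<in> mat_im (A ** transpose A). (A *v (x ^ 3)) \<bullet> (\<zeta> * x) \<ge> 0)) \<or>
       (mat_ker A = span {1} \<and>
          1 \<notin> mat_im (A ** transpose A) \<inter> mat_im (A ** A ** transpose A)))
      \<longrightarrow> proper (cubic_map A)"
  proof (intro impI, elim disjE exE conjE)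
    assume A: "upper_triangular_matrix A"
    have "wf (r\<inverse>)" by (rule finite_acyclic_wf_converse[OF _ acyc]) simp
    then show "proper (cubic_map A)"
      by (rule proper_cubic_map_triangular)
        (use A in \<open>force simp: r_def upper_triangular_matrix_def neq_iff\<close>)
  next
    assume A: "lower_triangular_matrix A"
    have "wf r" by (rule finite_acyclic_wf[OF _ acyc]) simp
    then show "proper (cubic_map A)"
      by (rule proper_cubic_map_triangular)
        (use A in \<open>force simp: r_def lower_triangular_matrix_def neq_iff\<close>)
  qed (auto intro: proper_cubic_map_ker proper_cubic_map_rank_1 proper_cubic_map_conjugate
      proper_cubic_map_weighted_inner proper_cubic_map_ker_span_1 simp: mat_im_mult_transpose)
  show "invertible A \<or> transpose A = A \<or> transpose A = - A
      \<longrightarrow> mat_ker A \<subseteq> mat_ker (A ** transpose A)"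
    using mat_ker_subset_if_invertible_or_symmetric by blast
  show "(\<exists>\<zeta>. (\<forall>i. \<zeta> $ i > 0) \<and>
         (\<forall>x \<in> mat_im (A ** transpose A). (A *v (x ^ 3)) \<bullet> (\<zeta> * x) \<ge> 0) \<and>
         (\<forall>x \<in> mat_im (A ** transpose A). x \<noteq> 0 \<longrightarrow> (A *v (x ^ 3)) \<bullet> (\<zeta> * x) \<noteq> 0))
      \<longrightarrow> proper (cubic_map (- A)) \<and> cubic_map (- A) = (\<lambda>x. x - (A *v x) ^ 3)"
  proof (intro impI conjI)
    show "cubic_map (- A) = (\<lambda>x. x - (A *v x) ^ 3)"
      by (simp add: fun_eq_iff cubic_map_def uminus_mat_mult)
    assume "\<exists>\<zeta>. (\<forall>i. \<zeta> $ i > 0) \<and>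
         (\<forall>x \<in> mat_im (A ** transpose A). (A *v (x ^ 3)) \<bullet> (\<zeta> * x) \<ge> 0) \<and>
         (\<forall>x \<in> mat_im (A ** transpose A). x \<noteq> 0 \<longrightarrow> (A *v (x ^ 3)) \<bullet> (\<zeta> * x) \<noteq> 0)"
    then obtain \<zeta> where \<zeta>: "\<And>x. x \<in> mat_im A \<Longrightarrow> x \<noteq> 0 \<Longrightarrow> (A *v (x ^ 3)) \<bullet> (\<zeta> * x) \<noteq> 0"
      unfolding mat_im_mult_transpose by blast
    \<comment> \<open>The sign changes neither the image nor the kernel. If
      \<open>A *v (w ^ 3) = 0\<close>, the pairing with \<open>\<zeta> * w\<close> vanishes, which
      forces \<open>w = 0\<close>.\<close>
    show "proper (cubic_map (- A))"
    proof (rule proper_cubic_map_if_trivial_cube_kernel)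
      fix w assume w: "w \<in> mat_im (- A)" "(- A) *v (w ^ 3) = 0"
      then obtain v where "w = - (A *v v)" by (auto simp: mat_im_def uminus_mat_mult)
      then have "w \<in> mat_im A"
        using subspace_neg[OF subspace_mat_im, of "A *v v" A] by (simp add: mat_im_def)
      then show "w = 0" using \<zeta>[of w] w by (auto simp: uminus_mat_mult)
    qed
  qed
qed

end
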